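(* If $f(z)=z+\sum_{n=2}^{\infty}a_nz^n\in \mathcal{S}_{S,e}^*$, then $$|H_{2,1}(F_{f^{-1}}/2)|=|\Gamma_1\Gamma_3-\Gamma_2^2|\leq\frac{1}{16}.$$ The inequality is sharp.
   Context: $\mathbb{D}=\{z\in\mathbb{C}:|z|<1\}$. $\mathcal{S}$ is the class of univalent (injective) analytic functions $f$ on $\mathbb{D}$ with expansion $f(z)=z+\sum_{n\ge 2}a_nz^n$. For analytic $g,h$ on $\mathbb{D}$, $g\prec h$ (subordination) means $g=h\circ w$ for some analytic $w:\mathbb{D}\to\mathbb{D}$ with $w(0)=0$. The class is $$\mathcal{S}_{S,e}^*=\left\{f\in\mathcal{S}:\ \frac{2zf'(z)}{f(z)-f(-z)}\prec e^z\right\}.$$ For $f\in\mathcal{S}$, let $F(w)=f^{-1}(w)=w+A_2w^2+A_3w^3+\cdots$ be the inverse function near $0$ (defined for $|w|<1/4$). The logarithmic inverse coefficients $\Gamma_n$ are defined by $\log\big(F(w)/w\big)=2\sum_{n\ge1}\Gamma_nw^n$, $|w|<1/4$ (branch with $\log 1=0$), and $H_{2,1}(F_{f^{-1}}/2):=\Gamma_1\Gamma_3-\Gamma_2^2$. "Sharp" means that equality is attained by some function in the class. *)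

theory Defs
  imports "HOL-Complex_Analysis.Complex_Analysis"
begin

definition unit_disc :: "complex set" where
  "unit_disc = ball 0 1"

definition class_S :: "(complex \<Rightarrow> complex) set" where
  "class_S = {f. f holomorphic_on unit_disc \<and> inj_on f unit_disc \<and> f 0 = 0 \<and> deriv f 0 = 1}"

definition subordinate :: "(complex \<Rightarrow> complex) \<Rightarrow> (complex \<Rightarrow> complex) \<Rightarrow> bool" where
  "subordinate g h \<longleftrightarrow>
     g holomorphic_on unit_disc \<and> h holomorphic_on unit_disc \<and>
     (\<exists>w. w holomorphic_on unit_disc \<and> w ` unit_disc \<subseteq> unit_disc \<and> w 0 = 0 \<and>
          (\<forall>z\<in>unit_disc. g z = h (w z)))"

(* For f in class_S the quotient has a removable singularity at 0, where it is given its limit 1;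
   injectivity of f makes the denominator nonzero at every other point of the disc. *)
definition sym_quotient :: "(complex \<Rightarrow> complex) \<Rightarrow> complex \<Rightarrow> complex" where
  "sym_quotient f z = (if z = 0 then 1 else 2 * z * deriv f z / (f z - f (- z)))"

definition class_S_sym_exp :: "(complex \<Rightarrow> complex) set" where
  "class_S_sym_exp = {f \<in> class_S. subordinate (sym_quotient f) exp}"

definition disc_inverse :: "(complex \<Rightarrow> complex) \<Rightarrow> complex \<Rightarrow> complex" where
  "disc_inverse f = inv_into unit_disc f"

(* log (F w / w) with its removable singularity at 0 filled in. Only the germ at 0 is used, and near 0
   the branch with log 1 = 0 is the principal one. *)
definition log_inv :: "(complex \<Rightarrow> complex) \<Rightarrow> complex \<Rightarrow> complex" where
  "log_inv f w = (if w = 0 then 0 else Ln (disc_inverse f w / w))"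

definition log_inv_coeff :: "(complex \<Rightarrow> complex) \<Rightarrow> nat \<Rightarrow> complex" where
  "log_inv_coeff f n = fps_nth (fps_expansion (log_inv f) 0) n / 2"

definition log_inv_hankel_2_1 :: "(complex \<Rightarrow> complex) \<Rightarrow> complex" where
  "log_inv_hankel_2_1 f =
     log_inv_coeff f 1 * log_inv_coeff f 3 - (log_inv_coeff f 2)\<^sup>2"

(* The coefficients are those of the power series 2 * (\<Sum>n\<ge>1. G n * w ^ n) of the branch L of
   log (F w / w) on the disc of radius 1/4 with L 0 = 0 (the series at 0 being 0). *)
lemma log_inv_coeff_eqI:
  fixes G :: "nat \<Rightarrow> complex" and L :: "complex \<Rightarrow> complex"
  assumes series: "\<And>w. norm w < 1 / 4 \<Longrightarrow> (\<lambda>n. 2 * G (Suc n) * w ^ Suc n) sums L w"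
    and branch: "\<And>w. 0 < norm w \<Longrightarrow> norm w < 1 / 4 \<Longrightarrow> exp (L w) = disc_inverse f w / w"
    and "n \<ge> 1"
  shows "log_inv_coeff f n = G n"
proof -
  define P where "P = Abs_fps (\<lambda>n. if n = 0 then 0 else 2 * G n)"
  have sums: "(\<lambda>n. fps_nth P n * w ^ n) sums L w" if "norm w < 1 / 4" for w
    using series[OF that] sums_Suc_iff[of "\<lambda>n. fps_nth P n * w ^ n" "L w"]
    by (simp add: P_def)
  have L: "L has_fps_expansion P"
  proof (rule has_fps_expansionI)
    have "eventually (\<lambda>w. w \<in> ball 0 (1/4)) (nhds (0::complex))"
      by (intro eventually_nhds_in_open) auto
    then show "\<forall>\<^sub>F w in nhds 0. (\<lambda>n. fps_nth P n * w ^ n) sums L w"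
      by eventually_elim (use sums in auto)
  qed
  have L0: "L 0 = 0"
    using has_fps_expansion_imp_0_eq_fps_nth_0[OF L] by (simp add: P_def)
  have "isCont L 0"
    using L has_fps_expansion_imp_continuous by blast
  then have "(L \<longlongrightarrow> 0) (nhds 0)"
    using L0 by (metis isContD tendsto_at_iff_tendsto_nhds)
  then have "((\<lambda>w. norm (L w)) \<longlongrightarrow> 0) (nhds 0)"
    by (rule tendsto_norm_zero)
  then have "eventually (\<lambda>w. norm (L w) < pi) (nhds 0)"
    by (rule order_tendstoD(2)) (rule pi_gt_zero)
  moreover have "eventually (\<lambda>w. w \<in> ball 0 (1/4)) (nhds (0::complex))"
    by (intro eventually_nhds_in_open) auto
  ultimately have "eventually (\<lambda>w. L w = log_inv f w) (nhds 0)"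
  proof eventually_elim
    case (elim w)
    show ?case
    proof (cases "w = 0")
      case False
      have "\<bar>Im (L w)\<bar> < pi"
        using elim(1) abs_Im_le_cmod[of "L w"] by linarith
      then have "Ln (exp (L w)) = L w"
        by (intro Ln_exp) auto
      then show ?thesis
        using False elim(2) branch[of w] by (simp add: log_inv_def)
    qed (simp add: L0 log_inv_def)
  qed
  then have "log_inv f has_fps_expansion P"
    using L has_fps_expansion_cong by blast
  then have "fps_expansion (log_inv f) 0 = P"
    by (rule fps_expansion_eqI)
  then show ?thesis
    using \<open>n \<ge> 1\<close> by (simp add: log_inv_coeff_def P_def)
qed

end

theory Submission
  imports Defs
begin

text \<open>
  Write the subordination as $2 z f'(z) = (f(z) - f(-z)) e^{w(z)}$ with $w = \sum c_n z^n$.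
  Comparing coefficients in this equation and in $e^{L(f(z))} f(z) = z$, where
  $L(\zeta) = \log (F(\zeta)/\zeta)$, gives
  \[ \Gamma_1\Gamma_3 - \Gamma_2^2 = \frac{1}{4} \Bigl(\frac{c_1 c_3}{8} - \frac{3 c_1^2 c_2}{16}
     - \frac{c_2^2}{4} - \frac{c_1^4}{192}\Bigr). \]
  Two steps of the Schur algorithm parametrise $(c_1, c_2, c_3)$ by three points of the closed
  disc, and then the triangle inequality suffices.

  Equality holds for $w = z^2$, that is, for $f(z) = z \exp (Q(z^2)/2)$ with $Q'(u) = (e^u - 1)/u$.
  In the coordinate $s = \log z$ the function $\log f$ has derivative $\exp (e^{2s})$, whose real
  part is positive on the convex half-plane $\Re s < 0$; hence $\log f$ is injective there, and since
  it commutes with the translation by $2 \pi i$, $f$ is univalent.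
\<close>

lemma has_fps_expansion_transform:
  fixes f g :: "complex \<Rightarrow> complex"
  assumes "f has_fps_expansion F" and "eventually (\<lambda>z. f z = g z) (nhds 0)"
  shows "g has_fps_expansion F"
  using assms has_fps_expansion_cong[OF assms(2) refl, of F] by simp

section \<open>Schwarz's lemma and the Schur algorithm\<close>

text \<open>The singularity of \<open>g z / z\<close> at 0 is removable, and the Schwarz lemma
  bounds the quotient, its value \<open>deriv g 0\<close> at 0 included. Since \<open>\<psi>\<close>
  is defined as this quotient everywhere, the factorisation needs no restriction on
  \<open>z\<close>.\<close>

lemma schwarz_quotient:
  assumes g: "g holomorphic_on ball 0 1" "g 0 = 0" and lt: "\<And>z. norm z < 1 \<Longrightarrow> norm (g z) < 1"
  obtains \<psi> where "\<psi> holomorphic_on ball 0 1" "\<And>z. z \<in> ball 0 1 \<Longrightarrow> norm (\<psi> z) \<le> 1"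
    "\<And>z. g z = z * \<psi> z"
proof
  let ?\<psi> = "\<lambda>z. if z = 0 then deriv g 0 else g z / z"
  show "?\<psi> holomorphic_on ball 0 1"
    using pole_lemma_open[OF g(1), of 0] g(2) by (simp cong: if_cong)
  show "norm (?\<psi> z) \<le> 1" if "z \<in> ball 0 1" for z
    using Schwarz_Lemma(1)[OF g lt, of z] Schwarz_Lemma(2)[OF g lt, of 0] that
    by (auto simp: norm_divide divide_le_eq_1)
  show "g z = z * ?\<psi> z" for z
    using g(2) by simp
qed

text \<open>Composing \<open>\<phi>\<close> with the disc automorphism that sends
  \<open>\<phi> 0\<close> to 0 gives a function to which Schwarz's lemma applies; solving for
  \<open>\<phi>\<close> yields the identity. Stated without division, it also covers an
  \<open>\<phi>\<close> of modulus 1 somewhere in the disc: this is constant by the maximum modulus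
  principle, and \<open>\<psi> = 0\<close> serves.\<close>

lemma schur_step:
  assumes \<phi>: "\<phi> holomorphic_on ball 0 1" and le: "\<And>z. z \<in> ball 0 1 \<Longrightarrow> norm (\<phi> z) \<le> 1"
  obtains \<psi> where "\<psi> holomorphic_on ball 0 1" "\<And>z. z \<in> ball 0 1 \<Longrightarrow> norm (\<psi> z) \<le> 1"
    "\<And>z. z \<in> ball 0 1 \<Longrightarrow> \<phi> z * (1 + cnj (\<phi> 0) * (z * \<psi> z)) = \<phi> 0 + z * \<psi> z"
proof (cases "\<exists>a\<in>ball 0 1. norm (\<phi> a) = 1")
  case True
  then obtain a where a: "a \<in> ball 0 1" "norm (\<phi> a) = 1" by blast
  have "\<phi> constant_on ball 0 1"
    by (rule maximum_modulus_principle[OF \<phi>, of "ball 0 1" a]) (use a le in auto)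
  then have const: "\<phi> z = \<phi> 0" if "z \<in> ball 0 1" for z
    using that unfolding constant_on_def by (metis centre_in_ball zero_less_one)
  show thesis
  proof (rule that[of "\<lambda>_. 0"])
    show "\<phi> z * (1 + cnj (\<phi> 0) * (z * 0)) = \<phi> 0 + z * 0" if "z \<in> ball 0 1" for z
      using const[OF that] by simp
  qed auto
next
  case False
  then have lt: "norm (\<phi> z) < 1" if "norm z < 1" for z
    using le[of z] that by force
  let ?M = "Moebius_function 0 (\<phi> 0)"
  have 1: "norm (\<phi> 0) < 1" using lt by simp
  have "(?M \<circ> \<phi>) holomorphic_on ball 0 1"
    by (rule holomorphic_on_compose_gen[OF \<phi> Moebius_function_holomorphic[OF 1]]) (use lt in auto)
  moreover have "(?M \<circ> \<phi>) 0 = 0" by (simp add: Moebius_function_eq_zero)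
  moreover have "norm ((?M \<circ> \<phi>) z) < 1" if "norm z < 1" for z
    using Moebius_function_norm_lt_1[OF 1 lt[OF that]] by simp
  ultimately obtain \<psi> where \<psi>: "\<psi> holomorphic_on ball 0 1" "\<And>z. z \<in> ball 0 1 \<Longrightarrow> norm (\<psi> z) \<le> 1"
    and eq: "\<And>z. (?M \<circ> \<phi>) z = z * \<psi> z"
    using schwarz_quotient by blast
  have "\<phi> z * (1 + cnj (\<phi> 0) * (z * \<psi> z)) = \<phi> 0 + z * \<psi> z" if "z \<in> ball 0 1" for z
  proof -
    have "norm (cnj (\<phi> 0) * \<phi> z) < 1"
      using norm_mult_less[of "cnj (\<phi> 0)" 1 "\<phi> z" 1] 1 lt[of z] that by simp
    then have "1 - cnj (\<phi> 0) * \<phi> z \<noteq> 0" by auto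
    then have "\<phi> z - \<phi> 0 = z * \<psi> z * (1 - cnj (\<phi> 0) * \<phi> z)"
      using eq[of z] by (simp add: Moebius_function_simple divide_simps)
    then show ?thesis by algebra
  qed
  then show thesis using \<psi> that by blast
qed

text \<open>Equality of germs at 0 turns the Schur step into an identity of formal power series,
  from which coefficients can be read off.\<close>

lemma schur_step_fps:
  assumes \<phi>: "\<phi> has_fps_expansion A" "\<phi> holomorphic_on ball 0 1"
    and le: "\<And>z. z \<in> ball 0 1 \<Longrightarrow> norm (\<phi> z) \<le> 1"
  obtains \<psi> B where "\<psi> has_fps_expansion B" "\<psi> holomorphic_on ball 0 1"
    "\<And>z. z \<in> ball 0 1 \<Longrightarrow> norm (\<psi> z) \<le> 1"
    "A * (1 + fps_const (cnj (fps_nth A 0)) * (fps_X * B)) = fps_const (fps_nth A 0) + fps_X * B"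
proof -
  obtain \<psi> where \<psi>: "\<psi> holomorphic_on ball 0 1" "\<And>z. z \<in> ball 0 1 \<Longrightarrow> norm (\<psi> z) \<le> 1"
    and eq: "\<And>z. z \<in> ball 0 1 \<Longrightarrow> \<phi> z * (1 + cnj (\<phi> 0) * (z * \<psi> z)) = \<phi> 0 + z * \<psi> z"
    using schur_step[OF \<phi>(2) le] by blast
  define B where "B = fps_expansion \<psi> 0"
  have B: "\<psi> has_fps_expansion B"
    unfolding B_def using \<psi>(1) by (intro has_fps_expansion_fps_expansion[of "ball 0 1"]) auto
  have A0: "fps_nth A 0 = \<phi> 0"
    using has_fps_expansion_imp_0_eq_fps_nth_0[OF \<phi>(1)] by simp
  let ?l = "\<lambda>z. \<phi> z * (1 + cnj (\<phi> 0) * (z * \<psi> z))" and ?r = "\<lambda>z. \<phi> 0 + z * \<psi> z"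
  have l: "?l has_fps_expansion A * (1 + fps_const (cnj (\<phi> 0)) * (fps_X * B))"
    by (intro fps_expansion_intros \<phi>(1) B)
  have r: "?r has_fps_expansion fps_const (\<phi> 0) + fps_X * B"
    by (intro fps_expansion_intros B)
  have "eventually (\<lambda>z. z \<in> ball 0 1) (nhds (0::complex))"
    by (intro eventually_nhds_in_open) auto
  then have "eventually (\<lambda>z. ?l z = ?r z) (nhds 0)"
    by eventually_elim (use eq in auto)
  with l have "?r has_fps_expansion A * (1 + fps_const (cnj (\<phi> 0)) * (fps_X * B))"
    by (rule has_fps_expansion_transform)
  then have "A * (1 + fps_const (cnj (\<phi> 0)) * (fps_X * B)) = fps_const (\<phi> 0) + fps_X * B"
    using r fps_expansion_unique_complex by blast
  then show thesis using that[OF B \<psi>] by (simp add: A0)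
qed

lemma norm_fps_nth_0_le_1:
  assumes "\<phi> has_fps_expansion A" "\<And>z. z \<in> ball 0 1 \<Longrightarrow> norm (\<phi> z) \<le> 1"
  shows "norm (fps_nth A 0) \<le> 1"
  using has_fps_expansion_imp_0_eq_fps_nth_0[OF assms(1)] assms(2)[of 0] by simp

text \<open>The points \<open>c\<close>, \<open>x\<close>, \<open>\<zeta>\<close> are the Schur
  parameters of \<open>w z / z\<close>: the values at 0 of this quotient and of the two functions
  produced from it by successive Schur steps. Coefficient \<open>n + 1\<close> of \<open>W\<close>
  is coefficient \<open>n\<close> of the quotient.\<close>

lemma schwarz_coeffs:
  assumes w: "w has_fps_expansion W" "w holomorphic_on ball 0 1" "w 0 = 0"
    and lt: "\<And>z. norm z < 1 \<Longrightarrow> norm (w z) < 1"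
  obtains c x \<zeta> where "norm c \<le> 1" "norm x \<le> 1" "norm \<zeta> \<le> 1"
    "fps_nth W 0 = 0"
    "fps_nth W 1 = c" "fps_nth W 2 = (1 - c * cnj c) * x"
    "fps_nth W 3 = (1 - c * cnj c) * ((1 - x * cnj x) * \<zeta> - cnj c * x\<^sup>2)"
proof -
  obtain \<phi> where \<phi>: "\<phi> holomorphic_on ball 0 1" "\<And>z. z \<in> ball 0 1 \<Longrightarrow> norm (\<phi> z) \<le> 1"
    and w\<phi>: "\<And>z. w z = z * \<phi> z"
    using schwarz_quotient[OF w(2,3) lt] by blast
  define A where "A = fps_expansion \<phi> 0"
  have A: "\<phi> has_fps_expansion A"
    unfolding A_def using \<phi>(1) by (intro has_fps_expansion_fps_expansion[of "ball 0 1"]) auto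
  have "(\<lambda>z. z * \<phi> z) has_fps_expansion fps_X * A"
    by (intro fps_expansion_intros A)
  moreover have "w = (\<lambda>z. z * \<phi> z)" using w\<phi> by blast
  ultimately have W: "W = fps_X * A"
    using w(1) fps_expansion_unique_complex by blast
  obtain \<psi> B where B: "\<psi> has_fps_expansion B" "\<psi> holomorphic_on ball 0 1"
    "\<And>z. z \<in> ball 0 1 \<Longrightarrow> norm (\<psi> z) \<le> 1"
    and AB: "A * (1 + fps_const (cnj (fps_nth A 0)) * (fps_X * B)) = fps_const (fps_nth A 0) + fps_X * B"
    using schur_step_fps[OF A \<phi>] by metis
  obtain \<omega> C where C: "\<omega> has_fps_expansion C" "\<omega> holomorphic_on ball 0 1"
    "\<And>z. z \<in> ball 0 1 \<Longrightarrow> norm (\<omega> z) \<le> 1"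
    and BC: "B * (1 + fps_const (cnj (fps_nth B 0)) * (fps_X * C)) = fps_const (fps_nth B 0) + fps_X * C"
    using schur_step_fps[OF B] by metis
  have s: "{0..2::nat} = {0,1,2}" by auto
  have AB': "fps_nth (A * (1 + fps_const (cnj (fps_nth A 0)) * (fps_X * B))) n =
      fps_nth (fps_const (fps_nth A 0) + fps_X * B) n" for n
    using AB by simp
  have BC': "fps_nth (B * (1 + fps_const (cnj (fps_nth B 0)) * (fps_X * C))) n =
      fps_nth (fps_const (fps_nth B 0) + fps_X * C) n" for n
    using BC by simp
  let ?c = "fps_nth A 0" and ?x = "fps_nth B 0"
  have A1: "fps_nth A 1 = (1 - ?c * cnj ?c) * ?x"
    using AB'[of 1] by (simp add: algebra_simps)
  have B1: "fps_nth B 1 = (1 - ?x * cnj ?x) * fps_nth C 0"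
    using BC'[of 1] by (simp add: algebra_simps)
  \<comment> \<open>Inserting \<open>A1\<close>, the terms without \<open>fps_nth B 1\<close> also
    carry the factor \<open>1 - ?c * cnj ?c\<close>, which can then be taken out of the whole
    expression.\<close>
  have "fps_nth A 2 + fps_nth A 1 * (cnj ?c * ?x) + ?c * (cnj ?c * fps_nth B 1) = fps_nth B 1"
    using AB'[of 2] by (simp add: fps_mult_nth s algebra_simps)
  then have A2: "fps_nth A 2 = (1 - ?c * cnj ?c) * ((1 - ?x * cnj ?x) * fps_nth C 0 - cnj ?c * ?x\<^sup>2)"
    unfolding A1 B1 power2_eq_square by (simp add: algebra_simps)
  show thesis
  proof (rule that[of ?c ?x "fps_nth C 0"])
    show "norm ?c \<le> 1" "norm ?x \<le> 1" "norm (fps_nth C 0) \<le> 1"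
      using norm_fps_nth_0_le_1 A B C \<phi> by metis+
    show "fps_nth W 1 = ?c" "fps_nth W 0 = 0" by (simp_all add: W)
    have "fps_nth W 2 = fps_nth A 1" by (simp add: W)
    then show "fps_nth W 2 = (1 - ?c * cnj ?c) * ?x" using A1 by metis
    have "fps_nth W 3 = fps_nth A 2" by (simp add: W)
    then show "fps_nth W 3 = (1 - ?c * cnj ?c) * ((1 - ?x * cnj ?x) * fps_nth C 0 - cnj ?c * ?x\<^sup>2)"
      using A2 by metis
  qed
qed

section \<open>The coefficient estimate\<close>

text \<open>Only the moduli of \<open>c\<close> and \<open>x\<close> survive the triangle
  inequality, provided that the \<open>x\<^sup>2\<close> terms from \<open>c * c3\<close> and from
  \<open>c2\<^sup>2\<close> are merged first. The bound 1/4 is reached at \<open>c = 0\<close>,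
  \<open>norm x = 1\<close>.\<close>

lemma hankel_bound:
  fixes c x \<zeta> :: complex
  assumes le: "norm c \<le> 1" "norm x \<le> 1" "norm \<zeta> \<le> 1"
    and c2: "c2 = (1 - c * cnj c) * x"
    and c3: "c3 = (1 - c * cnj c) * ((1 - x * cnj x) * \<zeta> - cnj c * x\<^sup>2)"
  shows "norm (c * c3 / 8 - 3 / 16 * c\<^sup>2 * c2 - c2\<^sup>2 / 4 - c ^ 4 / 192) \<le> 1 / 4"
proof -
  define r y where "r = norm c" and "y = norm x"
  have ry: "0 \<le> r" "r \<le> 1" "0 \<le> y" "y \<le> 1" using le by (auto simp: r_def y_def)
  have cc: "c * cnj c = of_real (r\<^sup>2)" "x * cnj x = of_real (y\<^sup>2)"
    using complex_norm_square[of c] complex_norm_square[of x] by (simp_all add: r_def y_def)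
  have r1: "r\<^sup>2 \<le> 1" and y1: "y\<^sup>2 \<le> 1" using ry by (simp_all add: power_le_one)
  let ?E = "c * c3 / 8 - 3 / 16 * c\<^sup>2 * c2 - c2\<^sup>2 / 4 - c ^ 4 / 192"
  have "c * c3 = (1 - c * cnj c) * ((1 - x * cnj x) * (c * \<zeta>) - (c * cnj c) * x\<^sup>2)"
    unfolding c3 by algebra
  note cc3 = this[unfolded cc]
  \<comment> \<open>The coefficient of \<open>x\<^sup>2\<close> combines
    \<open>r\<^sup>2 / 8\<close> and \<open>(1 - r\<^sup>2) / 4\<close>, both times
    \<open>1 - r\<^sup>2\<close>.\<close>
  then have E: "?E = of_real ((1 - r\<^sup>2) * (1 - y\<^sup>2) / 8) * (c * \<zeta>)
      - of_real ((1 - r\<^sup>2) * (2 - r\<^sup>2) / 8) * x\<^sup>2 - of_real (3 / 16 * (1 - r\<^sup>2)) * (c\<^sup>2 * x) - of_real (1 / 192) * c ^ 4"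
    unfolding c2 cc cc3 by (simp add: field_simps power2_eq_square)
  have "norm ?E \<le> (1 - r\<^sup>2) * (1 - y\<^sup>2) / 8 * (r * norm \<zeta>) + (1 - r\<^sup>2) * (2 - r\<^sup>2) / 8 * y\<^sup>2
      + 3 / 16 * (1 - r\<^sup>2) * (r\<^sup>2 * y) + 1 / 192 * r ^ 4"
  proof -
    have n0: "norm (of_real a * z) = a * norm z" if "a \<ge> 0" for a and z :: complex
      using that by (simp add: norm_mult)
    have n: "norm (of_real ((1 - r\<^sup>2) * (1 - y\<^sup>2) / 8) * (c * \<zeta>)) = (1 - r\<^sup>2) * (1 - y\<^sup>2) / 8 * (r * norm \<zeta>)"
      "norm (of_real ((1 - r\<^sup>2) * (2 - r\<^sup>2) / 8) * x\<^sup>2) = (1 - r\<^sup>2) * (2 - r\<^sup>2) / 8 * y\<^sup>2"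
      "norm (of_real (3 / 16 * (1 - r\<^sup>2)) * (c\<^sup>2 * x)) = 3 / 16 * (1 - r\<^sup>2) * (r\<^sup>2 * y)"
      "norm (of_real (1 / 192) * c ^ 4) = 1 / 192 * r ^ 4"
      using r1 y1 by (subst n0; simp add: norm_mult norm_power r_def y_def)+
    have "norm (u1 - u2 - u3 - u4) \<le> norm u1 + norm u2 + norm u3 + norm u4" for u1 u2 u3 u4 :: complex
      using norm_triangle_ineq4[of "u1 - u2 - u3" u4] norm_triangle_ineq4[of "u1 - u2" u3]
        norm_triangle_ineq4[of u1 u2] by linarith
    then show ?thesis
      unfolding E n[symmetric] .
  qed
  \<comment> \<open>Enlarging \<open>r * norm \<zeta>\<close> to \<open>2 - r\<^sup>2\<close> gives
    \<open>1 - y\<^sup>2\<close> and \<open>y\<^sup>2\<close> the same factor, so that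
    \<open>y\<close> drops out of the sum.\<close>
  also have "\<dots> \<le> (1 - r\<^sup>2) * (1 - y\<^sup>2) / 8 * (2 - r\<^sup>2) + (1 - r\<^sup>2) * (2 - r\<^sup>2) / 8 * y\<^sup>2
      + 3 / 16 * (1 - r\<^sup>2) * (r\<^sup>2 * 1) + 1 / 192 * r ^ 4"
  proof -
    have "r * norm \<zeta> \<le> 1" by (rule mult_le_one[OF ry(2) norm_ge_zero le(3)])
    then have "r * norm \<zeta> \<le> 2 - r\<^sup>2" using r1 by linarith
    then have "(1 - r\<^sup>2) * (1 - y\<^sup>2) / 8 * (r * norm \<zeta>) \<le> (1 - r\<^sup>2) * (1 - y\<^sup>2) / 8 * (2 - r\<^sup>2)"
      using r1 y1 by (intro mult_left_mono) simp_all
    moreover have "3 / 16 * (1 - r\<^sup>2) * (r\<^sup>2 * y) \<le> 3 / 16 * (1 - r\<^sup>2) * (r\<^sup>2 * 1)"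
      using r1 ry by (intro mult_left_mono) simp_all
    ultimately show ?thesis by linarith
  qed
  also have "\<dots> = 1 / 4 - 3 / 16 * r\<^sup>2 - 11 / 192 * r ^ 4"
    by (simp add: field_simps power2_eq_square power4_eq_xxxx)
  also have "\<dots> \<le> 1 / 4"
    using zero_le_power2[of r] zero_le_power[OF ry(1), of 4] by linarith
  finally show ?thesis .
qed

section \<open>Low-order coefficients of formal power series\<close>

lemma fps_nth_mult_2: "fps_nth (A * B) 2 = fps_nth A 0 * fps_nth B 2 + fps_nth A 1 * fps_nth B 1 + fps_nth A 2 * fps_nth B 0"
  for A B :: "'a :: comm_ring_1 fps"
  by (simp add: fps_mult_nth numeral_eq_Suc algebra_simps)

lemma fps_nth_mult_3: "fps_nth (A * B) 3 = fps_nth A 0 * fps_nth B 3 + fps_nth A 1 * fps_nth B 2 + fps_nth A 2 * fps_nth B 1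
    + fps_nth A 3 * fps_nth B 0"
  for A B :: "'a :: comm_ring_1 fps"
  by (simp add: fps_mult_nth numeral_eq_Suc algebra_simps)

lemma fps_nth_mult_4: "fps_nth (A * B) 4 = fps_nth A 0 * fps_nth B 4 + fps_nth A 1 * fps_nth B 3 + fps_nth A 2 * fps_nth B 2
    + fps_nth A 3 * fps_nth B 1 + fps_nth A 4 * fps_nth B 0"
  for A B :: "'a :: comm_ring_1 fps"
  by (simp add: fps_mult_nth numeral_eq_Suc algebra_simps)

lemmas fps_nth_mult_small = fps_mult_nth_0 fps_mult_nth_1 fps_nth_mult_2 fps_nth_mult_3 fps_nth_mult_4

lemma fps_nth_compose_small:
  fixes A B :: "'a :: comm_ring_1 fps"
  assumes "fps_nth B 0 = 0"
  shows "fps_nth (A oo B) 1 = fps_nth A 1 * fps_nth B 1"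
    and "fps_nth (A oo B) 2 = fps_nth A 1 * fps_nth B 2 + fps_nth A 2 * fps_nth B 1 ^ 2"
    and "fps_nth (A oo B) 3 = fps_nth A 1 * fps_nth B 3 + 2 * fps_nth A 2 * fps_nth B 1 * fps_nth B 2
           + fps_nth A 3 * fps_nth B 1 ^ 3"
proof -
  have s: "{0..1::nat} = {0,1}" "{0..2::nat} = {0,1,2}" "{0..3::nat} = {0,1,2,3}" by auto
  have p: "B ^ 2 = B * B" "B ^ 3 = B * (B * B)"
    by (simp_all add: power2_eq_square power3_eq_cube mult.assoc)
  show "fps_nth (A oo B) 1 = fps_nth A 1 * fps_nth B 1"
    by (simp add: fps_compose_nth s)
  show "fps_nth (A oo B) 2 = fps_nth A 1 * fps_nth B 2 + fps_nth A 2 * fps_nth B 1 ^ 2"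
    using assms by (simp add: fps_compose_nth s p fps_nth_mult_small power2_eq_square)
  show "fps_nth (A oo B) 3 = fps_nth A 1 * fps_nth B 3 + 2 * fps_nth A 2 * fps_nth B 1 * fps_nth B 2
           + fps_nth A 3 * fps_nth B 1 ^ 3"
    using assms
    by (simp add: fps_compose_nth s p fps_nth_mult_small power3_eq_cube algebra_simps del: One_nat_def)
qed

lemma fps_nth_exp_compose:
  fixes A :: "complex fps"
  assumes "fps_nth A 0 = 0"
  shows "fps_nth (fps_exp 1 oo A) 1 = fps_nth A 1"
    and "fps_nth (fps_exp 1 oo A) 2 = fps_nth A 2 + fps_nth A 1 ^ 2 / 2"
    and "fps_nth (fps_exp 1 oo A) 3 = fps_nth A 3 + fps_nth A 1 * fps_nth A 2 + fps_nth A 1 ^ 3 / 6"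
  by (simp_all add: fps_nth_compose_small[OF assms] fact_numeral del: One_nat_def)

text \<open>The hypothesis is the formal version of 2 z f'(z) = (f(z) - f(-z)) exp(w(z)). The odd
  part of f has no even coefficients, so comparing coefficients 2, 3 and 4 in turn gives linear
  equations for those of \<open>P\<close>.\<close>

lemma sym_exp_fps_coeffs:
  fixes P W :: "complex fps"
  assumes eq: "fps_const 2 * (fps_X * fps_deriv P) = (P - (P oo (fps_const (-1) * fps_X))) * (fps_exp 1 oo W)"
    and P: "fps_nth P 1 = 1" and W: "fps_nth W 0 = 0"
  shows "fps_nth P 2 = fps_nth W 1 / 2"
    and "fps_nth P 3 = fps_nth W 2 / 2 + fps_nth W 1 ^ 2 / 4"
    and "fps_nth P 4 = fps_nth W 3 / 4 + 3 / 8 * fps_nth W 1 * fps_nth W 2 + 5 / 48 * fps_nth W 1 ^ 3"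
proof -
  have c: "fps_nth (fps_const 2 * (fps_X * fps_deriv P)) n
      = fps_nth ((P - (P oo (fps_const (-1) * fps_X))) * (fps_exp 1 oo W)) n" for n
    using eq by simp
  have l: "fps_nth (fps_const 2 * (fps_X * fps_deriv P)) n = 2 * of_nat n * fps_nth P n" for n
    by (cases n) simp_all
  have r: "fps_nth (P - (P oo (fps_const (-1) * fps_X))) n = (1 - (-1) ^ n) * fps_nth P n" for n
    by (simp add: fps_compose_linear) (simp add: algebra_simps)
  note e = fps_nth_exp_compose[OF W]
  show 2: "fps_nth P 2 = fps_nth W 1 / 2"
    using c[of 2] unfolding l fps_nth_mult_small r e using P
    by (simp add: field_simps del: One_nat_def)
  show 3: "fps_nth P 3 = fps_nth W 2 / 2 + fps_nth W 1 ^ 2 / 4"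
    using c[of 3] unfolding l fps_nth_mult_small r e using P
    by (simp add: field_simps power2_eq_square del: One_nat_def) algebra
  show "fps_nth P 4 = fps_nth W 3 / 4 + 3 / 8 * fps_nth W 1 * fps_nth W 2 + 5 / 48 * fps_nth W 1 ^ 3"
    using c[of 4] unfolding l fps_nth_mult_small r e 3 using P
    by (simp add: field_simps power2_eq_square power3_eq_cube del: One_nat_def) algebra
qed

text \<open>Working with exp(L(f(z))) f(z) = z avoids computing the inverse function itself. As
  \<open>P\<close> starts with z, coefficient \<open>n + 1\<close> of the identity determines
  coefficient \<open>n\<close> of \<open>L\<close> from the earlier ones.\<close>

lemma log_inverse_fps_coeffs:
  fixes P L :: "complex fps"
  assumes eq: "(fps_exp 1 oo (L oo P)) * P = fps_X"
    and P: "fps_nth P 0 = 0" "fps_nth P 1 = 1" and L: "fps_nth L 0 = 0"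
  shows "fps_nth L 1 = - fps_nth P 2"
    and "fps_nth L 2 = 3 / 2 * fps_nth P 2 ^ 2 - fps_nth P 3"
    and "fps_nth L 3 = 4 * fps_nth P 2 * fps_nth P 3 - 10 / 3 * fps_nth P 2 ^ 3 - fps_nth P 4"
proof -
  have LP: "fps_nth (L oo P) 0 = 0" using L by simp
  have c: "fps_nth ((fps_exp 1 oo (L oo P)) * P) n = (if n = 1 then 1 else 0)" for n
    using eq by simp
  note e = fps_nth_exp_compose[OF LP] fps_nth_compose_small[OF P(1)]
  show 1: "fps_nth L 1 = - fps_nth P 2"
    using c[of 2] unfolding fps_nth_mult_small e using P by (simp add: eq_neg_iff_add_eq_0 add.commute)
  show 2: "fps_nth L 2 = 3 / 2 * fps_nth P 2 ^ 2 - fps_nth P 3"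
    using c[of 3] unfolding fps_nth_mult_small e 1 using P
    by (simp add: field_simps power2_eq_square)
  show "fps_nth L 3 = 4 * fps_nth P 2 * fps_nth P 3 - 10 / 3 * fps_nth P 2 ^ 3 - fps_nth P 4"
    using c[of 4] unfolding fps_nth_mult_small e 1 2 using P
    by (simp add: field_simps power2_eq_square power3_eq_cube) algebra
qed

section \<open>From functions in the class to their coefficients\<close>

lemma class_S_has_fps_expansion:
  assumes "f \<in> class_S"
  shows "f has_fps_expansion fps_expansion f 0"
    and "fps_nth (fps_expansion f 0) 0 = 0" and "fps_nth (fps_expansion f 0) 1 = 1"
proof -
  have "f holomorphic_on ball 0 1" "f 0 = 0" "deriv f 0 = 1"
    using assms by (auto simp: class_S_def unit_disc_def)
  then show "f has_fps_expansion fps_expansion f 0"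
    and "fps_nth (fps_expansion f 0) 0 = 0" and "fps_nth (fps_expansion f 0) 1 = 1"
    using has_fps_expansion_fps_expansion[of "ball 0 1" f] by (simp_all add: fps_nth_fps_expansion)
qed

lemma eventually_in_unit_disc: "eventually (\<lambda>z. z \<in> unit_disc) (nhds 0)"
  unfolding unit_disc_def by (intro eventually_nhds_in_open) auto

text \<open>The exponential cancels any branch of the logarithm, so the identity holds on the whole
  disc, even where the principal branch jumps.\<close>

lemma log_inv_compose:
  assumes f: "f \<in> class_S" and z: "z \<in> unit_disc"
  shows "exp (log_inv f (f z)) * f z = z"
proof (cases "z = 0")
  case True
  then show ?thesis using f by (simp add: class_S_def)
next
  case False
  have inj: "inj_on f unit_disc" and f0: "f 0 = 0" using f by (auto simp: class_S_def)
  have "f z \<noteq> 0"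
    using inj_onD[OF inj, of z 0] f0 z False by (auto simp: unit_disc_def)
  then show ?thesis
    using False inv_into_f_f[OF inj z] by (simp add: log_inv_def disc_inverse_def)
qed

text \<open>Analyticity at 0 has to be proved before the formal expansion says anything about the
  function. The inverse is holomorphic on the open image, its quotient by w extends holomorphically
  with value 1 at 0, and \<open>Ln\<close> is analytic near 1.\<close>

lemma log_inv_has_fps_expansion:
  assumes f: "f \<in> class_S"
  shows "log_inv f has_fps_expansion fps_expansion (log_inv f) 0"
proof -
  have hol: "f holomorphic_on unit_disc" and inj: "inj_on f unit_disc" and f0: "f 0 = 0" "deriv f 0 = 1"
    using f by (auto simp: class_S_def)
  have D: "open unit_disc" "0 \<in> unit_disc" by (auto simp: unit_disc_def)
  obtain g where g: "g holomorphic_on f ` unit_disc"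
    and g': "\<And>z. z \<in> unit_disc \<Longrightarrow> deriv f z * deriv g (f z) = 1"
    and gf: "\<And>z. z \<in> unit_disc \<Longrightarrow> g (f z) = z"
    using holomorphic_has_inverse[OF hol D(1) inj] by blast
  have op: "open (f ` unit_disc)" by (rule open_mapping_thm3[OF hol D(1) inj])
  have im: "0 \<in> f ` unit_disc" using D(2) f0 by (metis image_eqI)
  \<comment> \<open>The value at 0 is \<open>deriv g 0 = 1\<close>, so \<open>Ln (h 0) = 0\<close>
    agrees with the value of \<open>log_inv\<close> there.\<close>
  define h where "h = (\<lambda>w. if w = 0 then deriv g 0 else (g w - g 0) / (w - 0))"
  have g0: "g 0 = 0" "deriv g 0 = 1" using gf[OF D(2)] g'[OF D(2)] f0 by auto
  have "h holomorphic_on f ` unit_disc"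
    unfolding h_def by (rule pole_lemma_open[OF g op])
  then have "h analytic_on {0}" using op im analytic_at by blast
  then have "(\<lambda>w. Ln (h w)) analytic_on {0}"
    by (intro analytic_intros) (auto simp: h_def g0)
  then have "(\<lambda>w. Ln (h w)) has_fps_expansion fps_expansion (\<lambda>w. Ln (h w)) 0"
    by (rule analytic_at_imp_has_fps_expansion_0)
  moreover have "eventually (\<lambda>w. Ln (h w) = log_inv f w) (nhds 0)"
    using eventually_nhds_in_open[OF op im]
  proof eventually_elim
    case (elim w)
    then have "disc_inverse f w = g w"
      using gf inj by (auto simp: disc_inverse_def inv_into_f_f)
    then show ?case by (simp add: h_def log_inv_def g0)
  qed
  ultimately have "log_inv f has_fps_expansion fps_expansion (\<lambda>w. Ln (h w)) 0"
    by (rule has_fps_expansion_transform)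
  then show ?thesis using fps_expansion_eqI by metis
qed

lemma log_inv_coeffs:
  assumes f: "f \<in> class_S"
  defines "a \<equiv> fps_nth (fps_expansion f 0)"
  shows "log_inv_coeff f 1 = - a 2 / 2"
    and "log_inv_coeff f 2 = (3 / 2 * a 2 ^ 2 - a 3) / 2"
    and "log_inv_coeff f 3 = (4 * a 2 * a 3 - 10 / 3 * a 2 ^ 3 - a 4) / 2"
proof -
  define P L where "P = fps_expansion f 0" and "L = fps_expansion (log_inv f) 0"
  have P: "f has_fps_expansion P" "fps_nth P 0 = 0" "fps_nth P 1 = 1"
    using class_S_has_fps_expansion[OF f] by (simp_all add: P_def)
  have L: "log_inv f has_fps_expansion L"
    unfolding L_def by (rule log_inv_has_fps_expansion[OF f])
  have L0: "fps_nth L 0 = 0"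
    using has_fps_expansion_imp_0_eq_fps_nth_0[OF L] by (simp add: log_inv_def)
  have "(\<lambda>z. (exp \<circ> (log_inv f \<circ> f)) z * f z) has_fps_expansion (fps_exp 1 oo (L oo P)) * P"
    using L0 by (intro fps_expansion_intros P L) simp
  moreover have "eventually (\<lambda>z. (exp \<circ> (log_inv f \<circ> f)) z * f z = z) (nhds 0)"
    using eventually_in_unit_disc by eventually_elim (use log_inv_compose[OF f] in simp)
  ultimately have "(\<lambda>z. z) has_fps_expansion (fps_exp 1 oo (L oo P)) * P"
    by (rule has_fps_expansion_transform)
  then have eq: "(fps_exp 1 oo (L oo P)) * P = fps_X"
    using has_fps_expansion_fps_X fps_expansion_unique_complex by blast
  show "log_inv_coeff f 1 = - a 2 / 2"
    "log_inv_coeff f 2 = (3 / 2 * a 2 ^ 2 - a 3) / 2"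
    "log_inv_coeff f 3 = (4 * a 2 * a 3 - 10 / 3 * a 2 ^ 3 - a 4) / 2"
    using log_inverse_fps_coeffs[OF eq P(2,3) L0]
    by (simp_all add: log_inv_coeff_def L_def[symmetric] P_def[symmetric] a_def)
qed

lemma sym_exp_coeffs:
  assumes f: "f \<in> class_S" and W: "w has_fps_expansion W" "w 0 = 0"
    and eq: "\<And>z. z \<in> unit_disc \<Longrightarrow> sym_quotient f z = exp (w z)"
  defines "a \<equiv> fps_nth (fps_expansion f 0)"
  shows "a 2 = fps_nth W 1 / 2"
    and "a 3 = fps_nth W 2 / 2 + fps_nth W 1 ^ 2 / 4"
    and "a 4 = fps_nth W 3 / 4 + 3 / 8 * fps_nth W 1 * fps_nth W 2 + 5 / 48 * fps_nth W 1 ^ 3"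
proof -
  define P where "P = fps_expansion f 0"
  have P: "f has_fps_expansion P" "fps_nth P 0 = 0" "fps_nth P 1 = 1"
    using class_S_has_fps_expansion[OF f] by (simp_all add: P_def)
  have inj: "inj_on f unit_disc" using f by (simp add: class_S_def)
  have W0: "fps_nth W 0 = 0"
    using has_fps_expansion_imp_0_eq_fps_nth_0[OF W(1)] W(2) by simp
  let ?l = "\<lambda>z. 2 * (z * deriv f z)"
  let ?r = "\<lambda>z. (f z - (f \<circ> (\<lambda>z. (-1) * z)) z) * (exp \<circ> w) z"
  have l: "?l has_fps_expansion fps_const 2 * (fps_X * fps_deriv P)"
    by (intro fps_expansion_intros P)
  have r: "?r has_fps_expansion (P - (P oo (fps_const (-1) * fps_X))) * (fps_exp 1 oo W)"
    by (intro fps_expansion_intros P W W0) simp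
  \<comment> \<open>Injectivity permits clearing the denominator away from 0; at 0 both sides
    vanish.\<close>
  have "?l z = ?r z" if z: "z \<in> unit_disc" for z
  proof (cases "z = 0")
    case False
    have "f z \<noteq> f (- z)"
      using inj_onD[OF inj, of z "- z"] z False by (auto simp: unit_disc_def eq_neg_iff_add_eq_0)
    then show ?thesis
      using eq[OF z] False by (simp add: sym_quotient_def field_simps)
  qed simp
  then have "eventually (\<lambda>z. ?l z = ?r z) (nhds 0)"
    using eventually_in_unit_disc by (rule eventually_mono[rotated])
  with l have "?r has_fps_expansion fps_const 2 * (fps_X * fps_deriv P)"
    by (rule has_fps_expansion_transform)
  then have eq: "fps_const 2 * (fps_X * fps_deriv P) = (P - (P oo (fps_const (-1) * fps_X))) * (fps_exp 1 oo W)"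
    using r fps_expansion_unique_complex by blast
  show "a 2 = fps_nth W 1 / 2"
    "a 3 = fps_nth W 2 / 2 + fps_nth W 1 ^ 2 / 4"
    "a 4 = fps_nth W 3 / 4 + 3 / 8 * fps_nth W 1 * fps_nth W 2 + 5 / 48 * fps_nth W 1 ^ 3"
    using sym_exp_fps_coeffs[OF eq P(3) W0] by (simp_all add: a_def P_def[symmetric])
qed

text \<open>Eliminating the coefficients of \<open>f\<close> leaves a polynomial in those of the
  Schwarz function, which serves both the upper bound and the evaluation at the extremal
  function.\<close>

lemma log_inv_hankel_eq:
  assumes f: "f \<in> class_S" and W: "w has_fps_expansion W" "w 0 = 0"
    and eq: "\<And>z. z \<in> unit_disc \<Longrightarrow> sym_quotient f z = exp (w z)"
  defines "c \<equiv> fps_nth W"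
  shows "log_inv_hankel_2_1 f = (c 1 * c 3 / 8 - 3 / 16 * (c 1)\<^sup>2 * c 2 - (c 2)\<^sup>2 / 4 - c 1 ^ 4 / 192) / 4"
  unfolding log_inv_hankel_2_1_def log_inv_coeffs[OF f] c_def
  by (simp add: sym_exp_coeffs[OF f W eq] field_simps power2_eq_square power3_eq_cube power4_eq_xxxx)

section \<open>Construction of the extremal function\<close>

text \<open>This is the Noshiro-Warschawski criterion: on the segment from \<open>a\<close> to
  \<open>b\<close>, the real part of \<open>f / (b - a)\<close> has derivative
  \<open>Re (f' (p t)) > 0\<close>, so it strictly increases and the end values differ.\<close>

lemma inj_on_of_Re_deriv_pos:
  assumes S: "convex S" and f: "\<And>z. z \<in> S \<Longrightarrow> (f has_field_derivative f' z) (at z)"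
    and pos: "\<And>z. z \<in> S \<Longrightarrow> 0 < Re (f' z)"
  shows "inj_on f S"
proof (rule inj_onI, rule ccontr)
  fix a b assume ab: "a \<in> S" "b \<in> S" "f a = f b" "a \<noteq> b"
  define p where "p t = a + of_real t * (b - a)" for t :: real
  have p: "p t \<in> S" if "0 \<le> t" "t \<le> 1" for t
    using convexD[OF S ab(1,2), of "1 - t" t] that by (simp add: p_def scaleR_conv_of_real algebra_simps)
  have d: "((\<lambda>t. Re (f (p t) / (b - a))) has_real_derivative Re (f' (p t))) (at t)"
    if "0 \<le> t" "t \<le> 1" for t
  proof -
    have "(p has_vector_derivative (b - a)) (at t)"
      unfolding p_def by (auto intro!: derivative_eq_intros simp: scaleR_conv_of_real)
    then have "((f \<circ> p) has_vector_derivative (b - a) * f' (p t)) (at t)"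
      using f[OF p[OF that]] by (rule field_vector_diff_chain_at)
    then have "((\<lambda>t. f (p t) / (b - a)) has_vector_derivative (b - a) * f' (p t) / (b - a)) (at t)"
      unfolding o_def by (rule has_vector_derivative_divide)
    then have "((\<lambda>t. f (p t) / (b - a)) has_vector_derivative f' (p t)) (at t)"
      using ab(4) by simp
    then have "((\<lambda>t. Re (f (p t) / (b - a))) has_vector_derivative Re (f' (p t))) (at t)"
      by (rule bounded_linear.has_vector_derivative[OF bounded_linear_Re])
    then show ?thesis by (simp add: has_real_derivative_iff_has_vector_derivative)
  qed
  have "Re (f (p 0) / (b - a)) < Re (f (p 1) / (b - a))"
    by (rule DERIV_pos_imp_increasing) (use d p pos in \<open>auto intro!: exI\<close>)
  then show False using ab(3) by (simp add: p_def)
qed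

lemma expm1_primitive:
  obtains Q :: "complex \<Rightarrow> complex" where "Q 0 = 0"
    "\<And>u. (Q has_field_derivative (if u = 0 then 1 else (exp u - 1) / u)) (at u)"
proof -
  have "(\<lambda>u::complex. if u = 0 then deriv exp 0 else (exp u - exp 0) / (u - 0)) holomorphic_on UNIV"
    by (rule pole_lemma_open) (auto intro!: holomorphic_intros)
  moreover have "deriv exp (0::complex) = 1" using DERIV_imp_deriv[OF DERIV_exp[of 0]] by simp
  ultimately have "(\<lambda>u::complex. if u = 0 then 1 else (exp u - 1) / u) holomorphic_on UNIV"
    by (simp cong: if_cong)
  then obtain g where g: "\<And>u::complex. (g has_field_derivative (if u = 0 then 1 else (exp u - 1) / u)) (at u)"
    using holomorphic_convex_primitive'[of UNIV] by auto
  show thesis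
  proof (rule that[of "\<lambda>u. g u - g 0"])
    show "((\<lambda>u. g u - g 0) has_field_derivative (if u = 0 then 1 else (exp u - 1) / u)) (at u)" for u
      by (rule derivative_eq_intros g refl)+ simp
  qed simp
qed

lemma Re_exp_pos:
  assumes "norm u < 1" shows "0 < Re (exp u)"
proof -
  have "\<bar>Im u\<bar> < 1" using abs_Im_le_cmod[of u] assms by linarith
  then have "cos (Im u) > 0" using pi_gt3 by (intro cos_gt_zero_pi) auto
  then show ?thesis by (simp add: Re_exp)
qed

text \<open>For odd f the symmetric quotient is z f'(z) / f(z). Setting it equal to exp(z^2) makes
  the derivative of log(f(z)/z) equal to (exp(z^2) - 1)/z, which integrates to Q(z^2)/2.\<close>

lemma extremal_function:
  obtains f where "f \<in> class_S" "sym_quotient f holomorphic_on unit_disc"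
    "\<And>z. z \<in> unit_disc \<Longrightarrow> sym_quotient f z = exp (z\<^sup>2)"
proof -
  obtain Q :: "complex \<Rightarrow> complex" where Q0: "Q 0 = 0"
    and Q: "\<And>u. (Q has_field_derivative (if u = 0 then 1 else (exp u - 1) / u)) (at u)"
    using expm1_primitive by blast
  define f where "f z = z * exp (Q (z\<^sup>2) / 2)" for z
  define \<Phi> where "\<Phi> s = s + Q (exp (2 * s)) / 2" for s
  have f': "(f has_field_derivative exp (Q (z\<^sup>2) / 2) * exp (z\<^sup>2)) (at z)" for z
    unfolding f_def
    by (rule derivative_eq_intros DERIV_chain2[OF Q] refl)+
       (auto simp: field_simps power2_eq_square)
  have \<Phi>': "(\<Phi> has_field_derivative exp (exp (2 * s))) (at s)" for s
  proof -
    have "((\<lambda>s. exp (2 * s)) has_field_derivative 2 * exp (2 * s)) (at s)"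
      by (auto intro!: derivative_eq_intros)
    from DERIV_add[OF DERIV_ident DERIV_cdivide[OF DERIV_chain2[OF Q this]], of 2]
    show ?thesis unfolding \<Phi>_def by (rule DERIV_cong) (simp add: field_simps)
  qed
  have inj: "inj_on \<Phi> {s. Re s < 0}"
  proof (rule inj_on_of_Re_deriv_pos[OF _ \<Phi>'])
    show "convex {s. Re s < 0}" by (rule convex_halfspace_Re_lt)
    show "0 < Re (exp (exp (2 * s)))" if "s \<in> {s. Re s < 0}" for s
      using that by (intro Re_exp_pos) simp
  qed
  \<comment> \<open>Thus \<open>\<Phi>\<close> lifts \<open>f\<close> through the exponential, and
    univalence reduces to injectivity of \<open>\<Phi>\<close> modulo periods.\<close>
  have f_exp: "f (exp s) = exp (\<Phi> s)" for s
    by (simp add: f_def \<Phi>_def exp_add exp_double)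
  have f_nz: "f z \<noteq> 0" if "z \<noteq> 0" for z using that by (simp add: f_def)
  have "inj_on f unit_disc"
  proof (rule inj_onI)
    fix a b assume ab: "a \<in> unit_disc" "b \<in> unit_disc" "f a = f b"
    show "a = b"
    proof (cases "a = 0 \<or> b = 0")
      case True
      then show ?thesis using ab(3) f_nz by (metis f_def mult_zero_left)
    next
      case False
      define s t where "s = Ln a" and "t = Ln b"
      have st: "a = exp s" "b = exp t" using False by (simp_all add: s_def t_def)
      have neg: "Re s < 0" "Re t < 0" using ab(1,2) by (simp_all add: st unit_disc_def)
      obtain n :: int where n: "\<Phi> s = \<Phi> t + of_int (2 * n) * of_real pi * \<i>"
        using ab(3) by (auto simp: st f_exp exp_eq)
      \<comment> \<open>Shifting \<open>t\<close> by the period changes neither \<open>exp t\<close>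
        nor \<open>Re t\<close>, and it moves \<open>\<Phi> t\<close> onto \<open>\<Phi> s\<close>;
        injectivity on the half-plane then applies.\<close>
      define t' where "t' = t + of_int (2 * n) * of_real pi * \<i>"
      have "exp t' = exp t" by (auto simp: t'_def exp_eq)
      moreover from this have "exp (2 * t') = exp (2 * t)" by (simp only: exp_double)
      then have "\<Phi> t' = t' + Q (exp (2 * t)) / 2" by (simp only: \<Phi>_def)
      then have "\<Phi> t' = \<Phi> s" unfolding n by (simp add: \<Phi>_def t'_def)
      then have "t' = s" using inj_onD[OF inj] neg by (simp add: t'_def)
      ultimately show ?thesis by (simp add: st)
    qed
  qed
  moreover have "f holomorphic_on unit_disc"
    using f' by (auto simp: holomorphic_on_def field_differentiable_def intro: has_field_derivative_at_within)
  moreover have "deriv f 0 = 1"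
    using DERIV_imp_deriv[OF f'[of 0]] by (simp add: Q0)
  ultimately have S: "f \<in> class_S" by (simp add: class_S_def f_def)
  have sq: "sym_quotient f z = exp (z\<^sup>2)" for z
    using DERIV_imp_deriv[OF f'[of z]] by (simp add: sym_quotient_def) (simp add: f_def field_simps)
  then have "sym_quotient f = (\<lambda>z. exp (z\<^sup>2))" by blast
  then have "sym_quotient f holomorphic_on unit_disc"
    by (simp add: holomorphic_intros)
  with S sq show thesis using that by blast
qed

section \<open>The bound and its sharpness\<close>

theorem theorem2p3:
  shows "(\<forall>f\<in>class_S_sym_exp. cmod (log_inv_hankel_2_1 f) \<le> 1 / 16) \<and>
         (\<exists>f\<in>class_S_sym_exp. cmod (log_inv_hankel_2_1 f) = 1 / 16)"
proof
  show "\<forall>f\<in>class_S_sym_exp. cmod (log_inv_hankel_2_1 f) \<le> 1 / 16"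
  proof
    fix f assume "f \<in> class_S_sym_exp"
    then obtain w where f: "f \<in> class_S"
      and w: "w holomorphic_on ball 0 1" "w 0 = 0" "\<And>z. norm z < 1 \<Longrightarrow> norm (w z) < 1"
      and eq: "\<And>z. z \<in> unit_disc \<Longrightarrow> sym_quotient f z = exp (w z)"
      by (auto simp: class_S_sym_exp_def subordinate_def unit_disc_def image_subset_iff)
    have W: "w has_fps_expansion fps_expansion w 0"
      using w(1) by (intro has_fps_expansion_fps_expansion[of "ball 0 1"]) auto
    let ?c = "fps_nth (fps_expansion w 0)"
    have H: "log_inv_hankel_2_1 f =
        (?c 1 * ?c 3 / 8 - 3 / 16 * (?c 1)\<^sup>2 * ?c 2 - (?c 2)\<^sup>2 / 4 - ?c 1 ^ 4 / 192) / 4"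
      by (rule log_inv_hankel_eq[OF f W w(2) eq])
    show "cmod (log_inv_hankel_2_1 f) \<le> 1 / 16"
    proof (rule schwarz_coeffs[OF W w])
      fix c x \<zeta> :: complex
      assume c: "norm c \<le> 1" "norm x \<le> 1" "norm \<zeta> \<le> 1" "fps_nth (fps_expansion w 0) 1 = c"
        "fps_nth (fps_expansion w 0) 2 = (1 - c * cnj c) * x"
        "fps_nth (fps_expansion w 0) 3 = (1 - c * cnj c) * ((1 - x * cnj x) * \<zeta> - cnj c * x\<^sup>2)"
      show ?thesis
        using hankel_bound[OF c(1-3,5,6)] by (simp only: H c(4) norm_divide) simp
    qed
  qed
  obtain f where f: "f \<in> class_S" "sym_quotient f holomorphic_on unit_disc"
    and eq: "\<And>z. z \<in> unit_disc \<Longrightarrow> sym_quotient f z = exp (z\<^sup>2)"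
    using extremal_function by blast
  have "subordinate (sym_quotient f) exp"
    unfolding subordinate_def
    by (intro conjI exI[of _ "\<lambda>z. z\<^sup>2"])
       (use f eq in \<open>auto intro!: holomorphic_intros simp: unit_disc_def norm_power power_less_one_iff\<close>)
  then have "f \<in> class_S_sym_exp" using f by (simp add: class_S_sym_exp_def)
  \<comment> \<open>With Schwarz function z^2 only the second coefficient is nonzero, and it is 1,
    so the determinant equals (-1/4)/4.\<close>
  moreover have "cmod (log_inv_hankel_2_1 f) = 1 / 16"
    using log_inv_hankel_eq[OF f(1) has_fps_expansion_fps_X_power _ eq]
    by (simp add: fps_X_power_nth norm_divide)
  ultimately show "\<exists>f\<in>class_S_sym_exp. cmod (log_inv_hankel_2_1 f) = 1 / 16" by blast
qed

end
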